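(* Let $f:\mathbb{R}^n\to\mathbb{R}$ be a function with Lipschitz continuous gradient, i.e. there is a constant $L>0$ with $\|\nabla f(y_1)-\nabla f(y_2)\|\le L\|y_1-y_2\|$ for all $y_1,y_2\in\mathbb{R}^n$, and let $l\in\mathbb{R}$ be such that $f+\frac{l}{2}\|\cdot\|^2$ is convex. Let $g:\mathbb{R}^n\to(-\infty,\infty]$ be a proper closed function such that for every $x\in\mathbb{R}^n$ and $\gamma>0$ the set $\arg\min_{y}\{g(y)+\frac{1}{2\gamma}\|y-x\|^2\}$ is nonempty. Let $\frac32<\alpha\le 2$ and let $\gamma>0$ be chosen such that $$\frac{4-\alpha}{2}(1+\gamma L)^2+\frac{9-2\alpha}{2}\gamma l-\frac{1+\alpha}{2}<0.$$ Let $\{(u^t,v^t,x^t)\}_{t\ge1}$ be a sequence generated by the parameterized Douglas-Rachford iteration with parameters $\alpha,\gamma$ (from an arbitrary initial point $x^0\in\mathbb{R}^n$). Then the sequence $\{\mathcal{M}_\gamma(u^t,v^t,x^t)\}_{t\ge 1}$ is nonincreasing. Moreover, if a cluster point of the sequence $\{(u^t,v^t,x^t)\}$ exists, then $$\lim_{t\to\infty}\|x^{t+1}-x^t\|=\lim_{t\to\infty}\|v^{t+1}-u^{t+1}\|=0.$$ Furthermore, for any cluster point $(u^*,v^*,x^* )$ of the sequence, we have $u^*=v^*$ and $$0\in\nabla f(v^* )+\partial g(v^* )+\frac1\gamma(2-\alpha)v^*.$$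
   Context: $\|\cdot\|$ is the Euclidean norm and $\langle\cdot,\cdot\rangle$ the inner product on $\mathbb{R}^n$. A function with values in $(-\infty,\infty]$ is proper if its domain (the set where it is finite) is nonempty, and closed if it is proper and lower semicontinuous. Parameterized Douglas-Rachford iteration: given $x^0\in\mathbb{R}^n$, for $t=0,1,2,\dots$, $$u^{t+1}\in\arg\min_u\Big\{f(u)+\tfrac{1}{2\gamma}\|u-x^t\|^2\Big\},\quad v^{t+1}\in\arg\min_v\Big\{g(v)+\tfrac{1}{2\gamma}\|v-\alpha u^{t+1}+x^t\|^2\Big\},\quad x^{t+1}=x^t+(v^{t+1}-u^{t+1}).$$ Merit function: $$\mathcal{M}_\gamma(u,v,x):=f(u)+g(v)-\frac{1}{2\gamma}\|u-v\|^2+\frac1\gamma\langle x-(\alpha-1)u,\,v-u\rangle+\frac{2-\alpha}{2\gamma}\|u\|^2.$$ Limiting subdifferential of a proper function $h$ at $x\in\mathrm{dom}\,h$: $\partial h(x)$ is the set of $v\in\mathbb{R}^n$ for which there exist $x^t\to x$ with $h(x^t)\to h(x)$ and $v^t\to v$ such that $\liminf_{z\to x^t}\frac{h(z)-h(x^t)-\langle v^t,z-x^t\rangle}{\|z-x^t\|}\ge0$ for each $t$. *)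

theory Defs
  imports "HOL-Analysis.Analysis"
begin

definition arg_min_set :: "('a \<Rightarrow> 'b::linorder) \<Rightarrow> 'a set" where
  "arg_min_set h = {y. is_arg_min h (\<lambda>_. True) y}"

definition proper :: "('a \<Rightarrow> ereal) \<Rightarrow> bool" where
  "proper h \<longleftrightarrow> (\<forall>y. h y \<noteq> -\<infinity>) \<and> (\<exists>y. h y \<noteq> \<infinity>)"

text \<open>The filter \<^term>\<open>at y\<close> omits the point \<open>y\<close> itself; this does not affect the condition.\<close>

definition lower_semicontinuous :: "('a::topological_space \<Rightarrow> ereal) \<Rightarrow> bool" where
  "lower_semicontinuous h \<longleftrightarrow> (\<forall>y. h y \<le> Liminf (at y) h)"

definition closed_fun :: "('a::topological_space \<Rightarrow> ereal) \<Rightarrow> bool" where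
  "closed_fun h \<longleftrightarrow> proper h \<and> lower_semicontinuous h"

text \<open>The vectors satisfying the difference-quotient condition in the definition of the limiting
  subdifferential. Finiteness of \<open>h y\<close> is part of the condition, because in \<^typ>\<open>ereal\<close> the
  meaningless difference \<open>\<infinity> - \<infinity>\<close> evaluates to \<open>\<infinity>\<close>.\<close>

definition regular_subdifferential :: "('a::real_inner \<Rightarrow> ereal) \<Rightarrow> 'a \<Rightarrow> 'a set" where
  "regular_subdifferential h y = {w. \<bar>h y\<bar> \<noteq> \<infinity> \<and>
     0 \<le> Liminf (at y) (\<lambda>z. (h z - h y - ereal (w \<bullet> (z - y))) / ereal (norm (z - y)))}"

definition limiting_subdifferential :: "('a::real_inner \<Rightarrow> ereal) \<Rightarrow> 'a \<Rightarrow> 'a set" where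
  "limiting_subdifferential h y = {w. \<bar>h y\<bar> \<noteq> \<infinity> \<and>
     (\<exists>ys ws. ys \<longlonglongrightarrow> y \<and> (\<lambda>t. h (ys t)) \<longlonglongrightarrow> h y \<and> ws \<longlonglongrightarrow> w \<and>
       (\<forall>t::nat. ws t \<in> regular_subdifferential h (ys t)))}"

text \<open>The values \<open>u 0\<close> and \<open>v 0\<close> are unconstrained and not part of the iteration.\<close>

definition parameterized_DR ::
  "(real^'n \<Rightarrow> real) \<Rightarrow> (real^'n \<Rightarrow> ereal) \<Rightarrow> real \<Rightarrow> real \<Rightarrow>
   (nat \<Rightarrow> real^'n) \<Rightarrow> (nat \<Rightarrow> real^'n) \<Rightarrow> (nat \<Rightarrow> real^'n) \<Rightarrow> bool" where
  "parameterized_DR f g \<alpha> \<gamma> u v x \<longleftrightarrow> (\<forall>t.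
     u (Suc t) \<in> arg_min_set (\<lambda>y. f y + 1 / (2 * \<gamma>) * (norm (y - x t))\<^sup>2) \<and>
     v (Suc t) \<in> arg_min_set
       (\<lambda>y. g y + ereal (1 / (2 * \<gamma>) * (norm (y - \<alpha> *\<^sub>R u (Suc t) + x t))\<^sup>2)) \<and>
     x (Suc t) = x t + (v (Suc t) - u (Suc t)))"

definition merit ::
  "(real^'n \<Rightarrow> real) \<Rightarrow> (real^'n \<Rightarrow> ereal) \<Rightarrow> real \<Rightarrow> real \<Rightarrow>
   real^'n \<Rightarrow> real^'n \<Rightarrow> real^'n \<Rightarrow> ereal" where
  "merit f g \<alpha> \<gamma> u v x =
     ereal (f u) + g v +
     ereal (- (1 / (2 * \<gamma>) * (norm (u - v))\<^sup>2)
            + 1 / \<gamma> * ((x - (\<alpha> - 1) *\<^sub>R u) \<bullet> (v - u))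
            + (2 - \<alpha>) / (2 * \<gamma>) * (norm u)\<^sup>2)"

definition cluster_point :: "(nat \<Rightarrow> 'a::topological_space) \<Rightarrow> 'a \<Rightarrow> bool" where
  "cluster_point s p \<longleftrightarrow> (\<exists>r. strict_mono r \<and> (s \<circ> r) \<longlonglongrightarrow> p)"

end

theory Submission
  imports Defs
begin

text \<open>Optimality of the \<open>u\<close>-step gives \<open>x\<^sup>t = u\<^sup>t\<^sup>+\<^sup>1 + \<gamma> \<nabla>f(u\<^sup>t\<^sup>+\<^sup>1)\<close>, hence
  \<open>v\<^sup>t - u\<^sup>t\<^sup>+\<^sup>1 = \<gamma> e\<close> for the gradient increment \<open>e = \<nabla>f(u\<^sup>t\<^sup>+\<^sup>1) - \<nabla>f(u\<^sup>t)\<close>. Together with the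
  minimality of \<open>v\<^sup>t\<^sup>+\<^sup>1\<close> and the tangent inequality for \<open>f\<close>, this bounds one step of the merit
  function by a quadratic form in \<open>d = u\<^sup>t\<^sup>+\<^sup>1 - u\<^sup>t\<close> and \<open>\<gamma> e\<close>, which the step size condition makes at
  most a negative multiple of \<open>\<parallel>d\<parallel>\<^sup>2\<close>. At a cluster point lower semicontinuity of \<open>g\<close> bounds the merit
  function from below, so \<open>d\<close>, and with it \<open>x\<^sup>t\<^sup>+\<^sup>1 - x\<^sup>t = d + \<gamma> e\<close>, tends to zero. The regular
  subgradients supplied by the \<open>v\<close>-steps then converge to the required limiting subgradient,
  because minimality in the \<open>v\<close>-step forces the values of \<open>g\<close> to converge along the subsequence.\<close>

section \<open>Tangent bounds, proximal minimizers and lower semicontinuity\<close>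

lemma mem_arg_min_set_iff: "y \<in> arg_min_set h \<longleftrightarrow> (\<forall>z. h y \<le> h z)"
  by (auto simp: arg_min_set_def is_arg_min_def not_less)

text \<open>The convex function \<open>F\<close>, restricted to the line through \<open>z\<close>
  and \<open>y\<close>, satisfies the one-dimensional tangent inequality at parameter 0; expanding
  the squared norms leaves the quadratic defect.\<close>

lemma weakly_convex_above_tangent:
  fixes f :: "'a::real_inner \<Rightarrow> real"
  assumes cvx: "convex_on UNIV (\<lambda>y. f y + l / 2 * (norm y)\<^sup>2)"
    and deriv: "GDERIV f z :> D"
  shows "f z + D \<bullet> (y - z) - l / 2 * (norm (y - z))\<^sup>2 \<le> f y"
proof -
  define F where "F y = f y + l / 2 * (norm y)\<^sup>2" for y
  define h where "h s = F (z + s *\<^sub>R (y - z))" for s :: real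
  have "convex_on UNIV h"
  proof (rule convex_onI)
    fix t a b :: real
    assume t: "0 < t" "t < 1"
    have "z + ((1 - t) *\<^sub>R a + t *\<^sub>R b) *\<^sub>R (y - z)
        = (1 - t) *\<^sub>R (z + a *\<^sub>R (y - z)) + t *\<^sub>R (z + b *\<^sub>R (y - z))"
      by (simp add: algebra_simps)
    then show "h ((1 - t) *\<^sub>R a + t *\<^sub>R b) \<le> (1 - t) * h a + t * h b"
      unfolding h_def using convex_onD[OF cvx[folded F_def], of t] t by simp
  qed simp
  moreover have "(h has_real_derivative (D \<bullet> (y - z) + l * (z \<bullet> (y - z)))) (at 0)"
  proof -
    have f': "(f has_derivative (\<lambda>k. k \<bullet> D)) (at (z + 0 *\<^sub>R (y - z)))"
      using deriv by (simp add: gderiv_def inner_commute)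
    have "((\<lambda>s. f (z + s *\<^sub>R (y - z))) has_derivative (\<lambda>s. (s *\<^sub>R (y - z)) \<bullet> D)) (at 0)"
      by (rule has_derivative_compose[where f = "\<lambda>s. z + s *\<^sub>R (y - z)" and g = f, OF _ f'])
        (auto intro!: derivative_eq_intros)
    moreover have "((\<lambda>s. l / 2 * (norm (z + s *\<^sub>R (y - z)))\<^sup>2) has_derivative
        (\<lambda>s. l * (z \<bullet> (s *\<^sub>R (y - z))))) (at 0)"
      unfolding power2_norm_eq_inner
      by (auto intro!: derivative_eq_intros simp: inner_commute)
    ultimately have "(h has_derivative
        (\<lambda>s. (s *\<^sub>R (y - z)) \<bullet> D + l * (z \<bullet> (s *\<^sub>R (y - z))))) (at 0)"
      unfolding h_def F_def by (rule has_derivative_add)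
    then show ?thesis
      by (auto simp: has_field_derivative_def inner_commute algebra_simps
          elim!: has_derivative_eq_rhs)
  qed
  ultimately have "h 1 - h 0 \<ge> (D \<bullet> (y - z) + l * (z \<bullet> (y - z))) * (1 - 0)"
    by (intro convex_on_imp_above_tangent[of UNIV]) auto
  then have "f z + D \<bullet> (y - z) + l * (z \<bullet> (y - z)) + l / 2 * (norm z)\<^sup>2
      \<le> f y + l / 2 * (norm y)\<^sup>2"
    by (simp add: h_def F_def)
  moreover have "l / 2 * (norm y)\<^sup>2
      = l * (z \<bullet> (y - z)) + l / 2 * (norm z)\<^sup>2 + l / 2 * (norm (y - z))\<^sup>2"
    unfolding power2_norm_eq_inner
    by (simp add: inner_diff_left inner_diff_right inner_commute field_simps)
  ultimately show ?thesis
    by linarith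
qed

lemma arg_min_prox_gradient:
  fixes f :: "'a::real_inner \<Rightarrow> real"
  assumes "\<gamma> \<noteq> 0" and deriv: "GDERIV f y :> D"
    and min: "y \<in> arg_min_set (\<lambda>y. f y + 1 / (2 * \<gamma>) * (norm (y - x))\<^sup>2)"
  shows "x = y + \<gamma> *\<^sub>R D"
proof -
  let ?h' = "\<lambda>k. k \<bullet> D + 1 / \<gamma> * ((y - x) \<bullet> k)"
  have "((\<lambda>y. 1 / (2 * \<gamma>) * (norm (y - x))\<^sup>2) has_derivative
      (\<lambda>k. 1 / \<gamma> * ((y - x) \<bullet> k))) (at y)"
    unfolding power2_norm_eq_inner using \<open>\<gamma> \<noteq> 0\<close>
    by (auto intro!: derivative_eq_intros simp: inner_commute)
  then have "((\<lambda>y. f y + 1 / (2 * \<gamma>) * (norm (y - x))\<^sup>2) has_derivative ?h') (at y)"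
    using deriv by (intro has_derivative_add) (simp_all add: gderiv_def inner_commute)
  then have "?h' = (\<lambda>k. 0)"
    using min by (intro has_derivative_local_min) (auto simp: mem_arg_min_set_iff)
  \<comment> \<open>The chosen direction is \<gamma> times the gradient of the objective at
    \<open>y\<close>, so the vanishing derivative becomes a vanishing squared norm.\<close>
  then have "?h' (\<gamma> *\<^sub>R D + (y - x)) = 0"
    by meson
  then have "(\<gamma> *\<^sub>R D + (y - x)) \<bullet> (\<gamma> *\<^sub>R D + (y - x)) = 0"
    using \<open>\<gamma> \<noteq> 0\<close> by (simp add: inner_add_left inner_diff_left inner_commute field_simps)
  then have "\<gamma> *\<^sub>R D + (y - x) = 0"
    using inner_eq_zero_iff by blast
  then show ?thesis
    by (simp add: algebra_simps)
qed

lemma arg_min_prox_finite: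
  assumes "proper g" and "v \<in> arg_min_set (\<lambda>y. g y + ereal (q y))"
  shows "\<bar>g v\<bar> \<noteq> \<infinity>"
proof -
  obtain y where "g y \<noteq> \<infinity>"
    using assms(1) by (auto simp: proper_def)
  moreover have "g v + ereal (q v) \<le> g y + ereal (q y)"
    using assms(2) by (auto simp: mem_arg_min_set_iff)
  ultimately show ?thesis
    using assms(1) by (cases "g y"; cases "g v") (auto simp: proper_def)
qed

text \<open>Minimality places \<open>g\<close> above a concave quadratic that touches it at
  \<open>v\<close> with slope \<open>?w\<close>. The difference quotient is therefore at least
  \<open>- norm (y - v) / (2 * \<gamma>)\<close>, which tends to 0.\<close>

lemma arg_min_prox_regular_subdifferential:
  fixes g :: "'a::real_inner \<Rightarrow> ereal"
  assumes "\<gamma> > 0" and g_proper: "proper g"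
    and min: "v \<in> arg_min_set (\<lambda>y. g y + ereal (1 / (2 * \<gamma>) * (norm (y - z))\<^sup>2))"
  shows "(1 / \<gamma>) *\<^sub>R (z - v) \<in> regular_subdifferential g v"
proof -
  let ?w = "(1 / \<gamma>) *\<^sub>R (z - v)"
  have fin: "\<bar>g v\<bar> \<noteq> \<infinity>"
    using arg_min_prox_finite[OF g_proper min] .
  then obtain r where r: "g v = ereal r"
    by auto
  have quot: "ereal (- (1 / (2 * \<gamma>)) * norm (y - v))
      \<le> (g y - g v - ereal (?w \<bullet> (y - v))) / ereal (norm (y - v))" if "y \<noteq> v" for y
  proof (cases "g y")
    case (real s)
    have "r + 1 / (2 * \<gamma>) * (norm (v - z))\<^sup>2 \<le> s + 1 / (2 * \<gamma>) * (norm (y - z))\<^sup>2"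
      using min real r by (auto simp: mem_arg_min_set_iff dest!: spec[of _ y])
    moreover have "1 / (2 * \<gamma>) * (norm (y - z))\<^sup>2 - 1 / (2 * \<gamma>) * (norm (v - z))\<^sup>2
        = 1 / (2 * \<gamma>) * (norm (y - v))\<^sup>2 - ?w \<bullet> (y - v)"
      using \<open>\<gamma> > 0\<close> unfolding power2_norm_eq_inner
      by (simp add: inner_diff_left inner_diff_right inner_commute field_simps)
    ultimately have "- (1 / (2 * \<gamma>)) * (norm (y - v))\<^sup>2 \<le> s - r - ?w \<bullet> (y - v)"
      by simp
    then have "- (1 / (2 * \<gamma>)) * norm (y - v) \<le> (s - r - ?w \<bullet> (y - v)) / norm (y - v)"
      using that by (simp add: pos_le_divide_eq power2_eq_square)
    then show ?thesis
      using that real r by simp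
  next
    case PInf
    then show ?thesis
      using that r by simp
  next
    case MInf
    then show ?thesis
      using g_proper by (simp add: proper_def)
  qed
  have "((\<lambda>y. ereal (- (1 / (2 * \<gamma>)) * norm (y - v))) \<longlongrightarrow> ereal (- (1 / (2 * \<gamma>)) * norm (v - v))) (at v)"
    by (intro tendsto_intros)
  then have lim: "((\<lambda>y. ereal (- (1 / (2 * \<gamma>)) * norm (y - v))) \<longlongrightarrow> 0) (at v)"
    by (simp add: zero_ereal_def)
  have "0 \<le> Liminf (at v) (\<lambda>y. (g y - g v - ereal (?w \<bullet> (y - v))) / ereal (norm (y - v)))"
    unfolding le_Liminf_iff
  proof (intro allI impI)
    fix c :: ereal
    assume "c < 0"
    then have "\<forall>\<^sub>F y in at v. c < ereal (- (1 / (2 * \<gamma>)) * norm (y - v))"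
      using order_tendstoD(1)[OF lim] by blast
    moreover have "\<forall>\<^sub>F y in at v. y \<noteq> v"
      by (rule eventually_neq_at_within)
    ultimately show "\<forall>\<^sub>F y in at v. c < (g y - g v - ereal (?w \<bullet> (y - v))) / ereal (norm (y - v))"
      by eventually_elim (use quot less_le_trans in blast)
  qed
  then show ?thesis
    using fin by (simp add: regular_subdifferential_def)
qed

text \<open>The Liminf over the punctured filter says nothing about \<open>p\<close> itself; there
  \<open>c < g p\<close> is used, so \<open>w\<close> may also take the value
  \<open>p\<close>.\<close>

lemma lower_semicontinuous_eventually:
  assumes "lower_semicontinuous g" "(w \<longlongrightarrow> p) F" "c < g p"
  shows "\<forall>\<^sub>F j in F. c < g (w j)"
proof -
  have "\<forall>\<^sub>F y in at p. c < g y"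
    using assms(1,3) le_Liminf_iff[of "g p" "at p" g] by (auto simp: lower_semicontinuous_def)
  then have "\<forall>\<^sub>F y in nhds p. c < g y"
    using assms(3) by (auto simp: eventually_at_filter elim: eventually_mono)
  then show ?thesis
    using assms(2) eventually_compose_filterlim by blast
qed

section \<open>Optimality conditions of the two minimization steps\<close>

locale DR_splitting =
  fixes f :: "real^'n \<Rightarrow> real" and gradf :: "real^'n \<Rightarrow> real^'n"
    and g :: "real^'n \<Rightarrow> ereal"
    and L l \<alpha> \<gamma> :: real
    and u v x :: "nat \<Rightarrow> real^'n"
  assumes gradient: "\<And>y. GDERIV f y :> gradf y"
    and lipschitz: "\<And>y1 y2. norm (gradf y1 - gradf y2) \<le> L * norm (y1 - y2)"
    and weakly_convex: "convex_on UNIV (\<lambda>y. f y + l / 2 * (norm y)\<^sup>2)"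
    and closed: "closed_fun g"
    and alpha_le: "\<alpha> \<le> 2"
    and gamma_pos: "\<gamma> > 0"
    and gamma: "(4 - \<alpha>) / 2 * (1 + \<gamma> * L)\<^sup>2 + (9 - 2 * \<alpha>) / 2 * \<gamma> * l - (1 + \<alpha>) / 2 < 0"
    and iteration: "parameterized_DR f g \<alpha> \<gamma> u v x"
begin

lemma proper_g: "proper g" and lsc_g: "lower_semicontinuous g"
  using closed by (auto simp: closed_fun_def)

lemma v_minimizer:
  "v (Suc t) \<in> arg_min_set
     (\<lambda>y. g y + ereal (1 / (2 * \<gamma>) * (norm (y - (\<alpha> *\<^sub>R u (Suc t) - x t)))\<^sup>2))"
  using iteration by (auto simp: parameterized_DR_def algebra_simps)

lemma x_step: "x (Suc t) - x t = v (Suc t) - u (Suc t)"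
  using iteration by (auto simp: parameterized_DR_def)

text \<open>Stationarity in the u-step. Since \<open>x t\<close> becomes a continuous function of
  \<open>u (Suc t)\<close>, later limits only need convergence of the u- and v-iterates.\<close>

lemma x_eq: "x t = u (Suc t) + \<gamma> *\<^sub>R gradf (u (Suc t))"
  using iteration gamma_pos
  by (intro arg_min_prox_gradient[OF _ gradient]) (auto simp: parameterized_DR_def)

lemma g_v_finite: "\<bar>g (v (Suc t))\<bar> \<noteq> \<infinity>"
  using arg_min_prox_finite[OF proper_g v_minimizer] .

text \<open>Minimality in the v-step, with the real quadratic terms collected on one side. The
  descent estimate takes the previous v-iterate for \<open>y\<close>; the convergence of the values
  of \<open>g\<close> takes the limit point.\<close>

lemma g_v_le:
  "g (v (Suc t)) \<le> g y +
     ereal (1 / (2 * \<gamma>) * (norm (y - (\<alpha> *\<^sub>R u (Suc t) - x t)))\<^sup>2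
            - 1 / (2 * \<gamma>) * (norm (v (Suc t) - (\<alpha> *\<^sub>R u (Suc t) - x t)))\<^sup>2)"
proof -
  have "g (v (Suc t)) + ereal (1 / (2 * \<gamma>) * (norm (v (Suc t) - (\<alpha> *\<^sub>R u (Suc t) - x t)))\<^sup>2)
      \<le> g y + ereal (1 / (2 * \<gamma>) * (norm (y - (\<alpha> *\<^sub>R u (Suc t) - x t)))\<^sup>2)"
    using v_minimizer[of t] by (simp add: mem_arg_min_set_iff)
  then show ?thesis
    by (cases "g (v (Suc t))"; cases "g y") auto
qed

section \<open>The merit function along the iterates\<close>

definition merit_coupling :: "real^'n \<Rightarrow> real^'n \<Rightarrow> real^'n \<Rightarrow> real" where
  "merit_coupling a b c = - (1 / (2 * \<gamma>) * (norm (a - b))\<^sup>2)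
     + 1 / \<gamma> * ((c - (\<alpha> - 1) *\<^sub>R a) \<bullet> (b - a)) + (2 - \<alpha>) / (2 * \<gamma>) * (norm a)\<^sup>2"

text \<open>Index \<open>t\<close> refers to iterate \<open>t + 1\<close>, because
  \<open>u 0\<close> and \<open>v 0\<close> are unconstrained. By \<open>g_v_finite\<close>,
  \<open>real_of_ereal\<close> loses nothing here.\<close>

definition merit_seq :: "nat \<Rightarrow> real" where
  "merit_seq t = f (u (Suc t)) + real_of_ereal (g (v (Suc t)))
     + merit_coupling (u (Suc t)) (v (Suc t)) (x (Suc t))"

lemma merit_eq: "merit f g \<alpha> \<gamma> (u (Suc t)) (v (Suc t)) (x (Suc t)) = ereal (merit_seq t)"
  using g_v_finite[of t]
  by (cases "g (v (Suc t))") (auto simp: merit_def merit_seq_def merit_coupling_def)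

section \<open>Increments and the one-step descent estimate\<close>

definition increment :: "nat \<Rightarrow> real^'n" where
  "increment t = u (Suc (Suc t)) - u (Suc t)"

text \<open>With \<open>increment\<close> as \<open>d\<close>, this is the vector \<open>e\<close>
  of the opening comment, both shifted by one index.\<close>

definition gradient_increment :: "nat \<Rightarrow> real^'n" where
  "gradient_increment t = gradf (u (Suc (Suc t))) - gradf (u (Suc t))"

lemma norm_gradient_increment: "norm (gradient_increment t) \<le> L * norm (increment t)"
  unfolding gradient_increment_def increment_def by (rule lipschitz)

lemma x_increment: "x (Suc t) - x t = increment t + \<gamma> *\<^sub>R gradient_increment t"
  by (simp add: x_eq increment_def gradient_increment_def algebra_simps)

text \<open>The x-step equals both \<open>v (Suc t) - u (Suc t)\<close> and the sum in
  \<open>x_increment\<close>; removing the u-increment leaves the gradient part.\<close>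

lemma v_diff_next_u: "v (Suc t) - u (Suc (Suc t)) = \<gamma> *\<^sub>R gradient_increment t"
  using x_step[of t] x_increment[of t] by (simp add: increment_def algebra_simps)

text \<open>Adding the tangent inequalities at the two points, each evaluated at the other, cancels
  the values of \<open>f\<close>.\<close>

lemma gradient_increment_lower:
  "- l * (norm (increment t))\<^sup>2 \<le> gradient_increment t \<bullet> increment t"
  using weakly_convex_above_tangent[OF weakly_convex gradient, of "u (Suc t)" "u (Suc (Suc t))"]
    weakly_convex_above_tangent[OF weakly_convex gradient, of "u (Suc (Suc t))" "u (Suc t)"]
  unfolding increment_def gradient_increment_def norm_minus_commute[of "u (Suc t)"]
  by (simp add: inner_diff_left inner_diff_right inner_commute algebra_simps)

text \<open>The change of \<open>g\<close> is bounded by minimality in the v-step and the change of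
  \<open>f\<close> by a tangent; the factor \<open>2 * \<gamma>\<close> clears the
  denominators.\<close>

lemma merit_step:
  "2 * \<gamma> * (merit_seq (Suc t) - merit_seq t) \<le>
     2 * (norm (\<gamma> *\<^sub>R gradient_increment t))\<^sup>2
     + (4 - 2 * \<alpha>) * (increment t \<bullet> (\<gamma> *\<^sub>R gradient_increment t))
     + (\<gamma> * l - \<alpha> + 1) * (norm (increment t))\<^sup>2"
proof -
  define a b c a' b' where "a = u (Suc t)" and "b = v (Suc t)" and "c = x (Suc t)"
    and "a' = u (Suc (Suc t))" and "b' = v (Suc (Suc t))"
  note names = a_def b_def c_def a'_def b'_def
  obtain r s where rs: "g b = ereal r" "g b' = ereal s"
    using g_v_finite by (metis b_def b'_def ereal_real')
  have c': "x (Suc (Suc t)) = c + (b' - a')"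
    using x_step[of "Suc t"] by (simp add: names algebra_simps)
  have inc: "increment t = a' - a" "\<gamma> *\<^sub>R gradient_increment t = b - a'"
    using v_diff_next_u[of t] by (simp_all add: increment_def names)
  have "s \<le> r + (1 / (2 * \<gamma>) * (norm (b - (\<alpha> *\<^sub>R a' - c)))\<^sup>2
      - 1 / (2 * \<gamma>) * (norm (b' - (\<alpha> *\<^sub>R a' - c)))\<^sup>2)"
    using g_v_le[of "Suc t" b] rs by (simp add: names)
  then have "2 * \<gamma> * s \<le> 2 * \<gamma> * (r + (1 / (2 * \<gamma>) * (norm (b - (\<alpha> *\<^sub>R a' - c)))\<^sup>2
      - 1 / (2 * \<gamma>) * (norm (b' - (\<alpha> *\<^sub>R a' - c)))\<^sup>2))"
    using gamma_pos by simp
  also have "\<dots> = 2 * \<gamma> * r + (norm (b - (\<alpha> *\<^sub>R a' - c)))\<^sup>2 - (norm (b' - (\<alpha> *\<^sub>R a' - c)))\<^sup>2"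
    using gamma_pos by (simp add: field_simps)
  finally have g_le: "2 * \<gamma> * s \<le> 2 * \<gamma> * r + (norm (b - (\<alpha> *\<^sub>R a' - c)))\<^sup>2
      - (norm (b' - (\<alpha> *\<^sub>R a' - c)))\<^sup>2" .
  \<comment> \<open>The tangent is taken at the new point \<open>a'\<close>, where
    \<open>x_eq\<close> turns the scaled gradient into \<open>c - a'\<close>.\<close>
  have "f a' + gradf a' \<bullet> (a - a') - l / 2 * (norm (a - a'))\<^sup>2 \<le> f a"
    by (rule weakly_convex_above_tangent[OF weakly_convex gradient])
  then have "2 * \<gamma> * (f a' + gradf a' \<bullet> (a - a') - l / 2 * (norm (a - a'))\<^sup>2) \<le> 2 * \<gamma> * f a"
    using gamma_pos by simp
  moreover have "\<gamma> *\<^sub>R gradf a' = c - a'"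
    using x_eq[of "Suc t"] by (simp add: names)
  then have "\<gamma> * (gradf a' \<bullet> (a - a')) = (c - a') \<bullet> (a - a')"
    by (metis inner_scaleR_left)
  ultimately have f_le: "2 * \<gamma> * f a' \<le>
      2 * \<gamma> * f a - 2 * ((c - a') \<bullet> (a - a')) + \<gamma> * l * (norm (a - a'))\<^sup>2"
    by (simp add: algebra_simps)
  have coupling: "2 * \<gamma> * merit_coupling p q w = - (norm (p - q))\<^sup>2
      + 2 * ((w - (\<alpha> - 1) *\<^sub>R p) \<bullet> (q - p)) + (2 - \<alpha>) * (norm p)\<^sup>2" for p q w
    using gamma_pos by (simp add: merit_coupling_def field_simps)
  have "2 * \<gamma> * (merit_seq (Suc t) - merit_seq t)
      = (2 * \<gamma> * f a' + 2 * \<gamma> * s + 2 * \<gamma> * merit_coupling a' b' (c + (b' - a')))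
        - (2 * \<gamma> * f a + 2 * \<gamma> * r + 2 * \<gamma> * merit_coupling a b c)"
    unfolding merit_seq_def c'[symmetric] using rs by (simp add: names algebra_simps)
  \<comment> \<open>After \<open>g_le\<close> and \<open>f_le\<close> are inserted, all terms
    containing \<open>c\<close> or \<open>b'\<close> cancel; what remains is a quadratic form in
    \<open>a' - a\<close> and \<open>b - a'\<close>.\<close>
  also have "\<dots> \<le> 2 * (norm (b - a'))\<^sup>2 + (4 - 2 * \<alpha>) * ((a' - a) \<bullet> (b - a'))
      + (\<gamma> * l - \<alpha> + 1) * (norm (a' - a))\<^sup>2"
    using g_le f_le unfolding coupling power2_norm_eq_inner
    by (simp add: inner_diff_left inner_diff_right inner_add_left inner_add_right
        inner_commute algebra_simps)
  finally show ?thesis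
    by (simp add: inc)
qed

text \<open>The slack in the step size condition, scaled to the units of the merit function.\<close>

definition decrease_rate :: real where
  "decrease_rate =
     ((1 + \<alpha>) / 2 - (4 - \<alpha>) / 2 * (1 + \<gamma> * L)\<^sup>2 - (9 - 2 * \<alpha>) / 2 * \<gamma> * l) / \<gamma>"

lemma decrease_rate_pos: "decrease_rate > 0"
  unfolding decrease_rate_def using gamma gamma_pos by (intro divide_pos_pos) linarith+

text \<open>The Lipschitz bound and Cauchy-Schwarz reduce the form in \<open>merit_step\<close> to a
  multiple of the squared increment, whose coefficient is then compared with the step size
  polynomial.\<close>

lemma merit_decrease: "merit_seq (Suc t) \<le> merit_seq t - decrease_rate * (norm (increment t))\<^sup>2"
proof (cases "increment t = 0")
  \<comment> \<open>A zero increment is split off because the bound \<open>- b \<le> a\<close> below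
    is obtained by cancelling the squared norm of \<open>?d\<close>.\<close>
  case True
  then have "gradient_increment t = 0"
    using norm_gradient_increment[of t] by simp
  then have "2 * \<gamma> * (merit_seq (Suc t) - merit_seq t) \<le> 0"
    using merit_step[of t] True by simp
  then show ?thesis
    using gamma_pos True by (simp add: mult_le_0_iff)
next
  case False
  let ?d = "increment t" and ?e = "\<gamma> *\<^sub>R gradient_increment t"
  define a b where "a = \<gamma> * L" and "b = \<gamma> * l"
  have e_le: "norm ?e \<le> a * norm ?d"
    using norm_gradient_increment[of t] gamma_pos by (simp add: a_def)
  then have sq: "(norm ?e)\<^sup>2 \<le> a\<^sup>2 * (norm ?d)\<^sup>2"
    by (metis norm_ge_zero power_mono power_mult_distrib)
  have inner_le: "?d \<bullet> ?e \<le> a * (norm ?d)\<^sup>2"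
    using norm_cauchy_schwarz[of ?d ?e] mult_left_mono[OF e_le, of "norm ?d"]
    by (simp add: power2_eq_square mult_ac del: inner_scaleR_right norm_scaleR)
  have "\<gamma> * (- l * (norm ?d)\<^sup>2) \<le> \<gamma> * (gradient_increment t \<bullet> ?d)"
    using gradient_increment_lower[of t] gamma_pos by (intro mult_left_mono) auto
  then have "- b * (norm ?d)\<^sup>2 \<le> ?d \<bullet> ?e"
    by (simp add: b_def inner_commute)
  with inner_le have "- b * (norm ?d)\<^sup>2 \<le> a * (norm ?d)\<^sup>2"
    by linarith
  \<comment> \<open>The step size condition alone does not imply decrease; it needs \<open>l \<ge> - L\<close>, which holds
     because \<open>f\<close> cannot be strongly convex with a modulus above \<open>L\<close>.\<close>
  then have ab: "- b \<le> a"
    using False by (metis mult_le_cancel_right_pos zero_less_norm_iff zero_less_power)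
  \<comment> \<open>Since \<open>\<alpha> \<le> 2\<close>, the factor
    \<open>4 - 2 * \<alpha>\<close> is nonnegative and the upper bound on the inner product can be
    inserted.\<close>
  have "2 * \<gamma> * (merit_seq (Suc t) - merit_seq t)
      \<le> 2 * (a\<^sup>2 * (norm ?d)\<^sup>2) + (4 - 2 * \<alpha>) * (a * (norm ?d)\<^sup>2) + (b - \<alpha> + 1) * (norm ?d)\<^sup>2"
    using merit_step[of t] sq mult_left_mono[OF inner_le, of "4 - 2 * \<alpha>"] alpha_le
    by (simp add: b_def)
  also have "\<dots> = (2 * a\<^sup>2 + (4 - 2 * \<alpha>) * a + b - \<alpha> + 1) * (norm ?d)\<^sup>2"
    by (simp add: algebra_simps)
  also have "\<dots> \<le> ((4 - \<alpha>) * (1 + a)\<^sup>2 + (9 - 2 * \<alpha>) * b - (1 + \<alpha>)) * (norm ?d)\<^sup>2"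
  proof (rule mult_right_mono)
    \<comment> \<open>This expression is exactly the difference of the two coefficients being
      compared.\<close>
    have "0 \<le> (2 - \<alpha>) * (a - 1)\<^sup>2 + (8 - 2 * \<alpha>) * (a + b)"
      using alpha_le ab by simp
    then show "2 * a\<^sup>2 + (4 - 2 * \<alpha>) * a + b - \<alpha> + 1
        \<le> (4 - \<alpha>) * (1 + a)\<^sup>2 + (9 - 2 * \<alpha>) * b - (1 + \<alpha>)"
      by (simp add: power2_eq_square algebra_simps)
  qed simp
  also have "\<dots> = 2 * \<gamma> * (- decrease_rate * (norm ?d)\<^sup>2)"
    using gamma_pos by (simp add: decrease_rate_def a_def b_def field_simps)
  finally have "merit_seq (Suc t) - merit_seq t \<le> - decrease_rate * (norm ?d)\<^sup>2"
    using gamma_pos by (subst (asm) mult_le_cancel_left_pos) simp_all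
  then show ?thesis
    by simp
qed

section \<open>Monotonicity, lower bound and vanishing increments\<close>

lemma merit_seq_decseq: "decseq merit_seq"
proof (rule decseq_SucI)
  fix t
  have "0 \<le> decrease_rate * (norm (increment t))\<^sup>2"
    using decrease_rate_pos by simp
  then show "merit_seq (Suc t) \<le> merit_seq t"
    using merit_decrease[of t] by linarith
qed

text \<open>Along the subsequence the real terms converge and semicontinuity keeps \<open>g\<close>
  from dropping; monotonicity extends the bound to every index.\<close>

lemma merit_seq_bounded_below:
  assumes r: "strict_mono r"
    and lims: "(\<lambda>j. u (Suc (r j))) \<longlonglongrightarrow> us" "(\<lambda>j. v (Suc (r j))) \<longlonglongrightarrow> vs"
      "(\<lambda>j. x (Suc (r j))) \<longlonglongrightarrow> xs"
  shows "\<exists>B. \<forall>t. B \<le> merit_seq t"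
proof -
  \<comment> \<open>Finiteness of \<open>g vs\<close> is not established at this stage, so a real
    number below it serves as the bound.\<close>
  obtain c where c: "ereal c < g vs"
    using proper_g by (metis proper_def ereal_bot linorder_not_less)
  have "isCont f us"
    using gradient has_derivative_continuous unfolding gderiv_def by blast
  then have "(\<lambda>j. f (u (Suc (r j))) + merit_coupling (u (Suc (r j))) (v (Suc (r j))) (x (Suc (r j))))
      \<longlonglongrightarrow> f us + merit_coupling us vs xs"
    unfolding merit_coupling_def using lims by (intro tendsto_intros isCont_tendsto_compose[of _ f])
  then have "\<forall>\<^sub>F j in sequentially. f us + merit_coupling us vs xs - 1
      < f (u (Suc (r j))) + merit_coupling (u (Suc (r j))) (v (Suc (r j))) (x (Suc (r j)))"
    by (rule order_tendstoD) simp
  moreover have "\<forall>\<^sub>F j in sequentially. ereal c < g (v (Suc (r j)))"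
    by (rule lower_semicontinuous_eventually[OF lsc_g lims(2) c])
  ultimately have "\<forall>\<^sub>F j in sequentially. c + (f us + merit_coupling us vs xs - 1) \<le> merit_seq (r j)"
  proof eventually_elim
    case (elim j)
    then show ?case
      using g_v_finite[of "r j"] by (cases "g (v (Suc (r j)))") (auto simp: merit_seq_def)
  qed
  then obtain N where N: "c + (f us + merit_coupling us vs xs - 1) \<le> merit_seq (r j)" if "N \<le> j" for j
    by (auto simp: eventually_sequentially)
  have "c + (f us + merit_coupling us vs xs - 1) \<le> merit_seq t" for t
  proof -
    \<comment> \<open>The index \<open>max N t\<close> lies in the tail where the bound holds, and
      its image under \<open>r\<close> is not before \<open>t\<close>.\<close>
    have "t \<le> r (max N t)"
      using seq_suble[OF r, of "max N t"] by linarith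
    then show ?thesis
      using N[of "max N t"] decseqD[OF merit_seq_decseq] by fastforce
  qed
  then show ?thesis
    by blast
qed

text \<open>A bounded monotone sequence converges, so its consecutive differences vanish; these
  dominate \<open>decrease_rate\<close> times the squared increments.\<close>

lemma increment_tendsto_0:
  assumes "\<forall>t. B \<le> merit_seq t"
  shows "increment \<longlonglongrightarrow> 0"
proof -
  obtain M where M: "merit_seq \<longlonglongrightarrow> M"
    using decseq_convergent[OF merit_seq_decseq] assms by blast
  have "(\<lambda>t. (merit_seq t - merit_seq (Suc t)) / decrease_rate) \<longlonglongrightarrow> (M - M) / decrease_rate"
    using M LIMSEQ_Suc[OF M] decrease_rate_pos by (intro tendsto_intros) auto
  then have lim: "(\<lambda>t. (merit_seq t - merit_seq (Suc t)) / decrease_rate) \<longlonglongrightarrow> 0"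
    by simp
  have "(norm (increment t))\<^sup>2 \<le> (merit_seq t - merit_seq (Suc t)) / decrease_rate" for t
    using merit_decrease[of t] decrease_rate_pos by (simp add: field_simps)
  then have "(\<lambda>t. (norm (increment t))\<^sup>2) \<longlonglongrightarrow> 0"
    by (intro tendsto_sandwich[OF _ _ tendsto_const lim]) auto
  then have "(\<lambda>t. sqrt ((norm (increment t))\<^sup>2)) \<longlonglongrightarrow> sqrt 0"
    by (rule tendsto_real_sqrt)
  then show ?thesis
    by (simp add: tendsto_norm_zero_iff)
qed

lemma x_increment_tendsto_0:
  assumes "\<forall>t. B \<le> merit_seq t"
  shows "(\<lambda>t. x (Suc t) - x t) \<longlonglongrightarrow> 0"
proof -
  have "(\<lambda>t. L * norm (increment t)) \<longlonglongrightarrow> 0"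
    using increment_tendsto_0[OF assms] by (intro tendsto_mult_right_zero tendsto_norm_zero)
  then have "gradient_increment \<longlonglongrightarrow> 0"
    by (rule Lim_null_comparison[rotated]) (simp add: norm_gradient_increment)
  then have "(\<lambda>t. increment t + \<gamma> *\<^sub>R gradient_increment t) \<longlonglongrightarrow> 0 + \<gamma> *\<^sub>R 0"
    by (intro tendsto_intros increment_tendsto_0[OF assms])
  then show ?thesis
    by (simp add: x_increment)
qed

section \<open>Limits of the values of \<open>g\<close> and of its subgradients\<close>

lemma gradf_tendsto:
  assumes "(w \<longlongrightarrow> p) F"
  shows "((\<lambda>j. gradf (w j)) \<longlongrightarrow> gradf p) F"
proof -
  have "((\<lambda>j. w j - p) \<longlongrightarrow> 0) F"
    using assms by (simp add: LIM_zero)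
  then have "((\<lambda>j. L * norm (w j - p)) \<longlongrightarrow> 0) F"
    by (intro tendsto_mult_right_zero tendsto_norm_zero)
  then have "((\<lambda>j. gradf (w j) - gradf p) \<longlongrightarrow> 0) F"
    by (rule Lim_null_comparison[rotated]) (simp add: lipschitz)
  then show ?thesis
    by (rule LIM_zero_cancel)
qed

text \<open>Semicontinuity bounds the values from below. Minimality against \<open>vs\<close> bounds
  them from above, up to a correction that vanishes in the limit. Finiteness comes from comparison
  with a point of the domain of \<open>g\<close>.\<close>

lemma g_v_tendsto:
  assumes lims: "(\<lambda>j. u (Suc (r j))) \<longlonglongrightarrow> us" "(\<lambda>j. v (Suc (r j))) \<longlonglongrightarrow> vs"
  shows "\<bar>g vs\<bar> \<noteq> \<infinity>" and "(\<lambda>j. g (v (Suc (r j)))) \<longlonglongrightarrow> g vs"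
proof -
  define q where "q y j = 1 / (2 * \<gamma>) * (norm (y - (\<alpha> *\<^sub>R u (Suc (r j)) - x (r j))))\<^sup>2
            - 1 / (2 * \<gamma>) * (norm (v (Suc (r j)) - (\<alpha> *\<^sub>R u (Suc (r j)) - x (r j))))\<^sup>2" for y j
  \<comment> \<open>The pointwise limit of \<open>q\<close>, with \<open>x (r j)\<close> rewritten
    by \<open>x_eq\<close>; it vanishes at \<open>y = vs\<close>.\<close>
  define k where "k y = 1 / (2 * \<gamma>) * (norm (y - (\<alpha> *\<^sub>R us - (us + \<gamma> *\<^sub>R gradf us))))\<^sup>2
            - 1 / (2 * \<gamma>) * (norm (vs - (\<alpha> *\<^sub>R us - (us + \<gamma> *\<^sub>R gradf us))))\<^sup>2" for y
  have q: "q y \<longlonglongrightarrow> k y" for y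
    unfolding q_def k_def x_eq using lims by (intro tendsto_intros gradf_tendsto)
  have upper: "g (v (Suc (r j))) \<le> g y + ereal (q y j)" for y j
    unfolding q_def by (rule g_v_le)
  obtain y b where b: "g y = ereal b"
    using proper_g by (metis proper_def ereal_cases)
  have "g vs \<le> ereal (b + k y)"
  proof (rule ccontr)
    assume "\<not> ?thesis"
    \<comment> \<open>A level strictly between the two sides: semicontinuity eventually pushes the
      values of \<open>g\<close> above \<open>c\<close>, while \<open>upper\<close> pushes them
      below it.\<close>
    then obtain c where c: "b + k y < c" "ereal c < g vs"
      using ereal_dense2[of "ereal (b + k y)" "g vs"] by (auto simp: not_le)
    have "\<forall>\<^sub>F j in sequentially. ereal c < g (v (Suc (r j)))"
      by (rule lower_semicontinuous_eventually[OF lsc_g lims(2) c(2)])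
    moreover have "\<forall>\<^sub>F j in sequentially. q y j < c - b"
      using c(1) by (intro order_tendstoD[OF q]) simp
    ultimately have "\<forall>\<^sub>F j in sequentially. False"
    proof eventually_elim
      case (elim j)
      then have "ereal c < ereal (b + q y j)"
        using upper[of j y] b by (metis less_le_trans plus_ereal.simps(1))
      with elim show ?case
        by simp
    qed
    then show False
      by simp
  qed
  then show fin: "\<bar>g vs\<bar> \<noteq> \<infinity>"
    using proper_g by (auto simp: proper_def)
  have "(\<lambda>j. g vs + ereal (q vs j)) \<longlonglongrightarrow> g vs + ereal (k vs)"
    using fin by (intro tendsto_add_ereal tendsto_const) (auto intro: q)
  then have up: "(\<lambda>j. g vs + ereal (q vs j)) \<longlonglongrightarrow> g vs"
    by (simp add: k_def flip: zero_ereal_def)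
  show "(\<lambda>j. g (v (Suc (r j)))) \<longlonglongrightarrow> g vs"
  proof (rule order_tendstoI)
    fix a
    assume "a < g vs"
    then show "\<forall>\<^sub>F j in sequentially. a < g (v (Suc (r j)))"
      by (rule lower_semicontinuous_eventually[OF lsc_g lims(2)])
  next
    fix a
    assume "g vs < a"
    then have "\<forall>\<^sub>F j in sequentially. g vs + ereal (q vs j) < a"
      by (rule order_tendstoD[OF up])
    then show "\<forall>\<^sub>F j in sequentially. g (v (Suc (r j))) < a"
      by eventually_elim (use upper le_less_trans in blast)
  qed
qed

text \<open>The v-steps give regular subgradients \<open>w j\<close>, which \<open>x_eq\<close>
  makes continuous in the u- and v-iterates. \<open>g_v_tendsto\<close> adds the convergence of
  function values that a limiting subgradient requires.\<close>

lemma limit_stationary: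
  assumes lims: "(\<lambda>j. u (Suc (r j))) \<longlonglongrightarrow> p" "(\<lambda>j. v (Suc (r j))) \<longlonglongrightarrow> p"
  shows "- gradf p - (1 / \<gamma> * (2 - \<alpha>)) *\<^sub>R p \<in> limiting_subdifferential g p"
proof -
  define w where "w j = (1 / \<gamma>) *\<^sub>R (\<alpha> *\<^sub>R u (Suc (r j)) - x (r j) - v (Suc (r j)))" for j
  have "w j \<in> regular_subdifferential g (v (Suc (r j)))" for j
    unfolding w_def
    by (rule arg_min_prox_regular_subdifferential[OF gamma_pos proper_g v_minimizer])
  moreover have "w \<longlonglongrightarrow> (1 / \<gamma>) *\<^sub>R (\<alpha> *\<^sub>R p - (p + \<gamma> *\<^sub>R gradf p) - p)"
    unfolding w_def x_eq using lims by (intro tendsto_intros gradf_tendsto)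
  moreover have "(1 / \<gamma>) *\<^sub>R (\<alpha> *\<^sub>R p - (p + \<gamma> *\<^sub>R gradf p) - p)
      = - gradf p - (1 / \<gamma> * (2 - \<alpha>)) *\<^sub>R p"
  proof -
    have "(1 / \<gamma> * (2 - \<alpha>)) *\<^sub>R p = (1 / \<gamma>) *\<^sub>R (p + p - \<alpha> *\<^sub>R p)"
      by (simp add: algebra_simps diff_divide_distrib flip: scaleR_2)
    then show ?thesis
      using gamma_pos by (simp add: algebra_simps)
  qed
  ultimately show ?thesis
    unfolding limiting_subdifferential_def using g_v_tendsto[OF lims] lims(2) by auto
qed

section \<open>Cluster points of the iterates\<close>

lemma cluster_point_subsequence:
  assumes "cluster_point (\<lambda>t. (u (Suc t), v (Suc t), x (Suc t))) (us, vs, xs)"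
  obtains r where "strict_mono r" "(\<lambda>j. u (Suc (r j))) \<longlonglongrightarrow> us"
    "(\<lambda>j. v (Suc (r j))) \<longlonglongrightarrow> vs" "(\<lambda>j. x (Suc (r j))) \<longlonglongrightarrow> xs"
proof -
  obtain r where "strict_mono r"
    and r: "(\<lambda>j. (u (Suc (r j)), v (Suc (r j)), x (Suc (r j)))) \<longlonglongrightarrow> (us, vs, xs)"
    using assms by (auto simp: cluster_point_def o_def)
  then show thesis
    using that tendsto_fst[OF r] tendsto_fst[OF tendsto_snd[OF r]] tendsto_snd[OF tendsto_snd[OF r]]
    by simp
qed

lemma cluster_point_x_increment:
  assumes "cluster_point (\<lambda>t. (u (Suc t), v (Suc t), x (Suc t))) p"
  shows "(\<lambda>t. x (Suc t) - x t) \<longlonglongrightarrow> 0"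
proof -
  obtain us vs xs where p: "p = (us, vs, xs)"
    by (cases p)
  obtain B where "\<forall>t. B \<le> merit_seq t"
    using cluster_point_subsequence[OF assms[unfolded p]] merit_seq_bounded_below by metis
  then show ?thesis
    by (rule x_increment_tendsto_0)
qed

lemma cluster_point_stationary:
  assumes cp: "cluster_point (\<lambda>t. (u (Suc t), v (Suc t), x (Suc t))) (us, vs, xs)"
  shows "us = vs" and "- gradf vs - (1 / \<gamma> * (2 - \<alpha>)) *\<^sub>R vs \<in> limiting_subdifferential g vs"
proof -
  obtain r where r: "strict_mono r" "(\<lambda>j. u (Suc (r j))) \<longlonglongrightarrow> us" "(\<lambda>j. v (Suc (r j))) \<longlonglongrightarrow> vs"
    using cluster_point_subsequence[OF cp] by metis
  \<comment> \<open>The x-increments vanish along the whole sequence, and by \<open>x_step\<close>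
    they are the differences of v- and u-iterates.\<close>
  have "(\<lambda>j. v (Suc (r j)) - u (Suc (r j))) \<longlonglongrightarrow> 0"
    using LIMSEQ_subseq_LIMSEQ[OF cluster_point_x_increment[OF cp] r(1)] by (simp add: o_def x_step)
  then have "vs - us = 0"
    using tendsto_diff[OF r(3,2)] LIMSEQ_unique by blast
  then show "us = vs"
    by simp
  with r show "- gradf vs - (1 / \<gamma> * (2 - \<alpha>)) *\<^sub>R vs \<in> limiting_subdifferential g vs"
    using limit_stationary by blast
qed

end

theorem theorem3p4:
  fixes f :: "real^'n \<Rightarrow> real" and gradf :: "real^'n \<Rightarrow> real^'n"
    and g :: "real^'n \<Rightarrow> ereal"
    and L l \<alpha> \<gamma> :: real
    and u v x :: "nat \<Rightarrow> real^'n"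
  assumes gradient: "\<And>y. GDERIV f y :> gradf y"
    and L_pos: "L > 0"
    and lipschitz: "\<And>y1 y2. norm (gradf y1 - gradf y2) \<le> L * norm (y1 - y2)"
    and weakly_convex: "convex_on UNIV (\<lambda>y. f y + l / 2 * (norm y)\<^sup>2)"
    and closed: "closed_fun g"
    and prox_nonempty: "\<And>z c. c > 0 \<Longrightarrow>
      arg_min_set (\<lambda>y. g y + ereal (1 / (2 * c) * (norm (y - z))\<^sup>2)) \<noteq> {}"
    and alpha: "3 / 2 < \<alpha>" "\<alpha> \<le> 2"
    and gamma_pos: "\<gamma> > 0"
    and gamma: "(4 - \<alpha>) / 2 * (1 + \<gamma> * L)\<^sup>2 + (9 - 2 * \<alpha>) / 2 * \<gamma> * l - (1 + \<alpha>) / 2 < 0"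
    and iteration: "parameterized_DR f g \<alpha> \<gamma> u v x"
  shows "decseq (\<lambda>t. merit f g \<alpha> \<gamma> (u (Suc t)) (v (Suc t)) (x (Suc t))) \<and>
    ((\<exists>p. cluster_point (\<lambda>t. (u (Suc t), v (Suc t), x (Suc t))) p) \<longrightarrow>
      (\<lambda>t. norm (x (Suc t) - x t)) \<longlonglongrightarrow> 0 \<and>
      (\<lambda>t. norm (v (Suc t) - u (Suc t))) \<longlonglongrightarrow> 0) \<and>
    (\<forall>us vs xs. cluster_point (\<lambda>t. (u (Suc t), v (Suc t), x (Suc t))) (us, vs, xs) \<longrightarrow>
      us = vs \<and>
      0 \<in> (\<lambda>w. gradf vs + w + (1 / \<gamma> * (2 - \<alpha>)) *\<^sub>R vs) ` limiting_subdifferential g vs)"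
proof -
  interpret DR_splitting f gradf g L l \<alpha> \<gamma> u v x
    by (rule DR_splitting.intro[OF gradient lipschitz weakly_convex closed alpha(2) gamma_pos gamma
          iteration])
  have "decseq (\<lambda>t. merit f g \<alpha> \<gamma> (u (Suc t)) (v (Suc t)) (x (Suc t)))"
    using merit_seq_decseq by (simp add: merit_eq decseq_def)
  moreover have "(\<lambda>t. norm (x (Suc t) - x t)) \<longlonglongrightarrow> 0" "(\<lambda>t. norm (v (Suc t) - u (Suc t))) \<longlonglongrightarrow> 0"
    if "cluster_point (\<lambda>t. (u (Suc t), v (Suc t), x (Suc t))) p" for p
    using tendsto_norm_zero[OF cluster_point_x_increment[OF that]] by (simp_all add: x_step)
  moreover have "0 \<in> (\<lambda>w. gradf vs + w + (1 / \<gamma> * (2 - \<alpha>)) *\<^sub>R vs) ` limiting_subdifferential g vs"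
    if "cluster_point (\<lambda>t. (u (Suc t), v (Suc t), x (Suc t))) (us, vs, xs)" for us vs xs
    \<comment> \<open>The preimage of 0 is the subgradient from
      \<open>cluster_point_stationary\<close>, for which the three summands cancel.\<close>
    using cluster_point_stationary(2)[OF that] by (rule rev_image_eqI) simp
  ultimately show ?thesis
    using cluster_point_stationary(1) by blast
qed

end
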